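(* Consider the problem of finding $$g_{\rm v}(\tilde\phi_1)=\arg\min_g\int\mathcal F(g(\tilde\phi_1))\,d\tilde\phi_1\quad\text{subject to}\quad H(f,g)=\log M,$$ where $g$ is the density of the number of quantized subsections, $$\mathcal F(g(\tilde\phi_1))=\frac1{12}\tilde\theta_1^2\,g(\tilde\phi_1)^{-2}\,\sigma^2(\tilde\phi_1)\,f(\tilde\phi_1),$$ $$H(f,g)=H_{\rm d}(f)+\int-f(\tilde\phi_1)\log\big(g^{-1}(\tilde\phi_1)\big)\,d\tilde\phi_1,\qquad H_{\rm d}(f)=\int-f(\tilde\phi_1)\log f(\tilde\phi_1)\,d\tilde\phi_1,$$ and $M$ is the expected number of quantization steps in the sense of the constraint. The solution is $$g_{\rm v}(\tilde\phi_1)=K\,M\,\sigma(\tilde\phi_1),\qquad K=\exp L,$$ $$L=-H_{\rm d}(f)-\int f(\tilde\phi_1)\log\sigma(\tilde\phi_1)\,d\tilde\phi_1=\int f(\tilde\phi_1)\log\frac{f(\tilde\phi_1)}{\sigma(\tilde\phi_1)}\,d\tilde\phi_1.$$ Moreover, the optimized value is $$\int\mathcal F(g_{\rm v}(\tilde\phi_1))\,d\tilde\phi_1=\frac1{12}\tilde\theta_1^2\,K^{-2}M^{-2}.$$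
   Context: Setting: $\phi(t)=[u(t)\ u(t-1)\ \cdots\ u(t-n+1)]$ is the regressor vector of a finite impulse response system with output $y(t)=\phi(t)\theta$, $\theta\in\mathbb R^n$. $T$ is an orthogonal matrix with $T^{-1}\theta=[\tilde\theta_1,0,\dots,0]^{\rm T}$, and $\tilde\phi=\phi T=[\tilde\phi_1\ \cdots\ \tilde\phi_n]$, so $y=\tilde\theta_1\tilde\phi_1$. $f(\tilde\phi_1,\dots,\tilde\phi_n)$ is the joint density of $\tilde\phi$, $f(\tilde\phi_1)=\int f(\tilde\phi_1,\dots,\tilde\phi_n)\,d\tilde\phi_2\cdots d\tilde\phi_n$ is the marginal density (written $f$ in $H(f,g)$ and $H_{\rm d}(f)$), and $$\sigma(\tilde\phi_1)=\Big(f(\tilde\phi_1)^{-1}\int\Big(\sum_{k=1}^n\tilde\phi_k^2\Big)f(\tilde\phi_1,\dots,\tilde\phi_n)\,d\tilde\phi_2\cdots d\tilde\phi_n\Big)^{1/2}.$$ The output is quantized by a symmetric memoryless quantizer; equivalently, the $\tilde\phi_1$-axis is divided into quantized subsections. The density of the number of quantized subsections is the function $g$ such that $g(\tilde\phi_1)\,d\tilde\phi_1$ is the number of quantized subsections in $d\tilde\phi_1$ (so $g(\tilde\phi_1)^{-1}$ is the width of the quantization step at $\tilde\phi_1$). $H(f,g)$ is the high-resolution asymptotic approximation of the entropy of the quantized signal. Standing assumptions: the inputs $u(t)$ are mutually independent; $f(\phi)$ is continuous and, in the neighborhood of an arbitrary point $\tilde\phi^\circ$, $f(\tilde\phi)=\delta_0+\sum_i\delta_i(\tilde\phi_i-\tilde\phi_i^\circ)+\sum_{i,j}\delta_{ij}(\tilde\phi_i-\tilde\phi_i^\circ)(\tilde\phi_j-\tilde\phi_j^\circ)+O((\tilde\phi_i-\tilde\phi_i^\circ)(\tilde\phi_j-\tilde\phi_j^\circ)(\tilde\phi_k-\tilde\phi_k^\circ))$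 with $|\delta_\bullet|<\infty$; $\frac{d(\sigma^2(\tilde\phi_1)f(\tilde\phi_1))}{d\tilde\phi_1}<\infty$; the resolution of the quantizer is sufficiently high and $\frac{d\,g(\tilde\phi_1)^{-2}}{d\tilde\phi_1}<\infty$. *)

theory Defs
  imports "HOL-Probability.Probability" "HOL-Library.Landau_Symbols"
begin

text \<open>The index type \<open>'n\<close> carries an enumeration \<open>idx\<close> of its elements by
  \<open>0, \<dots>, n - 1\<close>, which fixes the order of the entries \<open>u(t), u(t-1), \<dots>, u(t-n+1)\<close>.\<close>

definition regressor :: "('n::finite \<Rightarrow> nat) \<Rightarrow> (int \<Rightarrow> 'w \<Rightarrow> real) \<Rightarrow> int \<Rightarrow> 'w \<Rightarrow> real ^ 'n" where
  "regressor idx u t w = (\<chi> i. u (t - int (idx i)) w)"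

text \<open>The vector with entry \<open>x\<close> at \<open>i\<close> and the entries of \<open>z\<close> elsewhere; integrals over all
  coordinates but the \<open>i\<close>-th are taken over \<open>z\<close>, with respect to the product Lebesgue measure.\<close>

definition glue :: "'n::finite \<Rightarrow> real \<Rightarrow> ('n \<Rightarrow> real) \<Rightarrow> real ^ 'n" where
  "glue i x z = (\<chi> j. if j = i then x else z j)"

definition lborel_others :: "'n::finite \<Rightarrow> ('n \<Rightarrow> real) measure" where
  "lborel_others i = (\<Pi>\<^sub>M j\<in>UNIV - {i}. lborel)"

definition marginal :: "'n::finite \<Rightarrow> (real ^ 'n \<Rightarrow> real) \<Rightarrow> real \<Rightarrow> real" where
  "marginal i f x = (\<integral>z. f (glue i x z) \<partial>lborel_others i)"

definition sq_slice :: "'n::finite \<Rightarrow> (real ^ 'n \<Rightarrow> real) \<Rightarrow> real \<Rightarrow> ('n \<Rightarrow> real) \<Rightarrow> real" where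
  "sq_slice i f x z = (\<Sum>k\<in>UNIV. (glue i x z $ k)\<^sup>2) * f (glue i x z)"

text \<open>Where the marginal density vanishes this is \<open>0\<close>, since \<open>inverse 0 = 0\<close>.\<close>

definition cond_rms :: "'n::finite \<Rightarrow> (real ^ 'n \<Rightarrow> real) \<Rightarrow> real \<Rightarrow> real" where
  "cond_rms i f x = sqrt (inverse (marginal i f x) * (\<integral>z. sq_slice i f x z \<partial>lborel_others i))"

definition second_order_expansion :: "(real ^ 'n::finite \<Rightarrow> real) \<Rightarrow> real ^ 'n \<Rightarrow> bool" where
  "second_order_expansion f a \<longleftrightarrow>
    (\<exists>(d0::real) (d1::'n \<Rightarrow> real) (d2::'n \<Rightarrow> 'n \<Rightarrow> real).
      (\<lambda>x. f x - (d0 + (\<Sum>i\<in>UNIV. d1 i * (x $ i - a $ i))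
                 + (\<Sum>i\<in>UNIV. \<Sum>j\<in>UNIV. d2 i j * (x $ i - a $ i) * (x $ j - a $ j))))
      \<in> O[nhds a](\<lambda>x. \<Sum>i\<in>UNIV. \<Sum>j\<in>UNIV. \<Sum>k\<in>UNIV.
                        \<bar>(x $ i - a $ i) * (x $ j - a $ j) * (x $ k - a $ k)\<bar>))"

definition diff_entropy :: "(real \<Rightarrow> real) \<Rightarrow> real" where
  "diff_entropy f = (\<integral>x. - f x * ln (f x) \<partial>lborel)"

definition quantized_entropy :: "(real \<Rightarrow> real) \<Rightarrow> (real \<Rightarrow> real) \<Rightarrow> real" where
  "quantized_entropy f g = diff_entropy f + (\<integral>x. - f x * ln (inverse (g x)) \<partial>lborel)"

definition distortion ::
    "real \<Rightarrow> (real \<Rightarrow> real) \<Rightarrow> (real \<Rightarrow> real) \<Rightarrow> (real \<Rightarrow> real) \<Rightarrow> real \<Rightarrow> real" where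
  "distortion \<theta>1 s f g x = 1 / 12 * \<theta>1\<^sup>2 * g x powi (- 2) * (s x)\<^sup>2 * f x"

text \<open>Positivity is required only almost everywhere on the support of \<open>f\<close>: outside it the value
  of \<open>g\<close> is irrelevant. It cannot be dropped, as \<open>0 powi (- 2) = 0\<close> and \<open>ln (inverse 0) = 0\<close>
  would make \<open>g x = 0\<close> (an infinitely wide step) look free. Integrability
  says that the integral in the entropy constraint exists.\<close>

definition feasible :: "(real \<Rightarrow> real) \<Rightarrow> real \<Rightarrow> (real \<Rightarrow> real) set" where
  "feasible f M = {g. g \<in> borel_measurable borel \<and> (\<forall>x. 0 \<le> g x) \<and>
     (AE x in lborel. 0 < f x \<longrightarrow> 0 < g x) \<and>
     integrable lborel (\<lambda>x. - f x * ln (inverse (g x))) \<and>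
     quantized_entropy f g = ln M}"

definition finite_slope :: "(real \<Rightarrow> real) \<Rightarrow> (real \<Rightarrow> real) set" where
  "finite_slope f = {g. \<forall>x. 0 < f x \<longrightarrow> 0 < g x \<and> (\<lambda>x. g x powi (- 2)) differentiable at x}"

text \<open>The objective is an extended nonnegative integral, so that a density with infinite
  distortion has value \<open>\<infinity>\<close> (the Bochner integral would be \<open>0\<close>).\<close>

definition optimal_density ::
    "real \<Rightarrow> (real \<Rightarrow> real) \<Rightarrow> (real \<Rightarrow> real) \<Rightarrow> (real \<Rightarrow> real) set \<Rightarrow> (real \<Rightarrow> real) \<Rightarrow> bool" where
  "optimal_density \<theta>1 s f G =
     is_arg_min (\<lambda>g. \<integral>\<^sup>+ x. ennreal (distortion \<theta>1 s f g x) \<partial>lborel) (\<lambda>g. g \<in> G)"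

end

theory Submission
  imports Defs
begin

text \<open>
  Write \<open>p\<close> for the marginal density, \<open>s\<close> for \<open>\<sigma>\<close> and \<open>c = K M\<close>. The constraint fixes
  \<open>\<integral> p ln g\<close>, and \<open>K\<close> is chosen so that \<open>g = c s\<close> meets it; hence every admissible \<open>g\<close> satisfies
  \<open>\<integral> p ln (c s / g) = 0\<close>. Up to the factor \<open>\<theta>1\<^sup>2 / 12\<close> the distortion is
  \<open>p (s / g)\<^sup>2 = c\<^sup>-\<^sup>2 p exp (2 ln (c s / g))\<close>, and the tangent inequality \<open>exp y \<ge> 1 + y\<close> bounds it
  below by \<open>c\<^sup>-\<^sup>2 p (1 + 2 ln (c s / g))\<close>, whose integral is \<open>c\<^sup>-\<^sup>2\<close> whatever \<open>g\<close> is. The density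
  \<open>c s\<close> attains this bound. Since \<open>exp y = 1 + y\<close> only for \<open>y = 0\<close>, every minimizer agrees with
  \<open>c s\<close> almost everywhere on the support of \<open>p\<close> (unless \<open>\<theta>1 = 0\<close>). The argument compares
  with each admissible density separately, so it remains valid on every smaller class containing
  \<open>c s\<close>.

  This needs two facts about the joint density: \<open>p\<close> integrates to \<open>1\<close> (Tonelli's theorem), and
  \<open>s > 0\<close> almost everywhere on the support of \<open>p\<close>. The latter holds because the sum of squares
  over the slice at \<open>x\<close> contains \<open>x\<^sup>2\<close>, so \<open>s x \<ge> \<bar>x\<bar>\<close> there; only \<open>x = 0\<close> escapes.
\<close>

section \<open>Integration over slices\<close>

lemma glue_inner_axis: "glue i x z \<bullet> axis j 1 = (if j = i then x else z j)"
  by (simp add: glue_def inner_axis)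

lemma measurable_glue [measurable]:
  "(\<lambda>(x, z). glue i x z) \<in> borel_measurable (lborel \<Otimes>\<^sub>M lborel_others i)"
proof (subst borel_measurable_euclidean_space, intro ballI)
  fix b :: "real ^ 'a" assume "b \<in> Basis"
  then obtain j where b: "b = axis j 1" by (auto simp: Basis_vec_def)
  show "(\<lambda>p. (case p of (x, z) \<Rightarrow> glue i x z) \<bullet> b)
      \<in> borel_measurable (lborel \<Otimes>\<^sub>M lborel_others i)"
  proof (cases "j = i")
    case True
    then show ?thesis by (simp add: b split_beta glue_inner_axis)
  next
    case False
    then have "(\<lambda>z. z j) \<in> borel_measurable (lborel_others i)"
      unfolding lborel_others_def
      using measurable_component_singleton[of j "UNIV - {i}" "\<lambda>_. lborel"] by simp
    then have "(\<lambda>p. snd p j) \<in> borel_measurable (lborel \<Otimes>\<^sub>M lborel_others i)"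
      by (rule measurable_compose[OF measurable_snd])
    then show ?thesis using False by (simp add: b split_beta glue_inner_axis)
  qed
qed

lemma measurable_glue_slice [measurable]: "glue i x \<in> borel_measurable (lborel_others i)"
  using measurable_compose[OF measurable_Pair1'[of x lborel "lborel_others i"] measurable_glue[of i]]
  by simp

lemma sigma_finite_lborel_others: "sigma_finite_measure (lborel_others i)"
proof -
  interpret product_sigma_finite "\<lambda>_. lborel :: real measure" ..
  show ?thesis unfolding lborel_others_def by (rule sigma_finite) simp
qed

text \<open>Both sides give an open box the product of its side lengths, which determines Lebesgue
  measure.\<close>

lemma lborel_eq_distr_glue:
  "(lborel :: (real ^ 'n::finite) measure)
     = distr (lborel \<Otimes>\<^sub>M lborel_others i) borel (\<lambda>(x, z). glue i x z)"
proof (rule lborel_eqI)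
  interpret product_sigma_finite "\<lambda>_. lborel :: real measure" ..
  interpret others: sigma_finite_measure "lborel_others i" by (rule sigma_finite_lborel_others)
  fix l u :: "real ^ 'n" assume lu: "\<And>b. b \<in> Basis \<Longrightarrow> l \<bullet> b \<le> u \<bullet> b"
  have le: "l $ j \<le> u $ j" for j
    using lu[of "axis j 1"] by (auto simp: inner_axis Basis_vec_def)
  have fin: "finite (UNIV - {i})" by simp
  have "(\<lambda>(x, z). glue i x z) -` box l u \<inter> space (lborel \<Otimes>\<^sub>M lborel_others i)
      = {l $ i <..< u $ i} \<times> (\<Pi>\<^sub>E j\<in>UNIV - {i}. {l $ j <..< u $ j})"
    (is "?V = ?I \<times> ?J")
  proof (rule set_eqI, clarify)
    fix x z
    have split: "(\<forall>j. Q j) \<longleftrightarrow> Q i \<and> (\<forall>j\<in>UNIV - {i}. Q j)" for Q :: "'n \<Rightarrow> bool" by blast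
    have "(x, z) \<in> ?V \<longleftrightarrow> z \<in> extensional (UNIV - {i}) \<and>
        (\<forall>j. l $ j < (if j = i then x else z j) \<and> (if j = i then x else z j) < u $ j)"
      by (simp add: mem_box_cart glue_def space_pair_measure lborel_others_def space_PiM PiE_def
          conj_commute)
    also have "\<dots> \<longleftrightarrow> z \<in> extensional (UNIV - {i}) \<and> (l $ i < x \<and> x < u $ i)
        \<and> (\<forall>j\<in>UNIV - {i}. l $ j < z j \<and> z j < u $ j)"
      by (subst split) simp
    also have "\<dots> \<longleftrightarrow> (x, z) \<in> ?I \<times> ?J"
      by (simp only: mem_Times_iff fst_conv snd_conv greaterThanLessThan_iff PiE_iff) blast
    finally show "(x, z) \<in> ?V \<longleftrightarrow> (x, z) \<in> ?I \<times> ?J" .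
  qed
  moreover have "?J \<in> sets (lborel_others i)"
    unfolding lborel_others_def by (rule sets_PiM_I_finite) auto
  moreover have "emeasure (lborel_others i) ?J = ennreal (\<Prod>j\<in>UNIV - {i}. u $ j - l $ j)"
    unfolding lborel_others_def using le
    by (subst emeasure_PiM[OF fin]) (auto simp: prod_ennreal)
  ultimately have "emeasure (distr (lborel \<Otimes>\<^sub>M lborel_others i) borel (\<lambda>(x, z). glue i x z)) (box l u)
      = ennreal (u $ i - l $ i) * ennreal (\<Prod>j\<in>UNIV - {i}. u $ j - l $ j)"
    using le by (simp add: emeasure_distr others.emeasure_pair_measure_Times)
  also have "\<dots> = ennreal (\<Prod>j\<in>UNIV. u $ j - l $ j)"
    using le by (simp add: ennreal_mult[symmetric] prod_nonneg prod.remove[of UNIV i])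
  also have "(\<Prod>j\<in>UNIV. u $ j - l $ j) = (\<Prod>b\<in>Basis. (u - l) \<bullet> b)"
  proof -
    have basis: "(Basis :: (real ^ 'n) set) = range (\<lambda>j. axis j 1)" by (auto simp: Basis_vec_def)
    have inj: "inj (\<lambda>j. axis j (1::real) :: real ^ 'n)" by (auto simp: inj_on_def axis_eq_axis)
    show ?thesis unfolding basis by (simp add: prod.reindex[OF inj] inner_axis)
  qed
  finally show "emeasure (distr (lborel \<Otimes>\<^sub>M lborel_others i) borel (\<lambda>(x, z). glue i x z)) (box l u)
      = ennreal (\<Prod>b\<in>Basis. (u - l) \<bullet> b)" .
qed simp

lemma nn_integral_slices:
  fixes F :: "real ^ 'n::finite \<Rightarrow> ennreal"
  assumes [measurable]: "F \<in> borel_measurable borel"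
  shows "(\<integral>\<^sup>+ v. F v \<partial>lborel) = (\<integral>\<^sup>+ x. \<integral>\<^sup>+ z. F (glue i x z) \<partial>lborel_others i \<partial>lborel)"
proof -
  interpret others: sigma_finite_measure "lborel_others i" by (rule sigma_finite_lborel_others)
  have "(\<integral>\<^sup>+ v. F v \<partial>lborel)
      = (\<integral>\<^sup>+ p. F (case p of (x, z) \<Rightarrow> glue i x z) \<partial>(lborel \<Otimes>\<^sub>M lborel_others i))"
    by (subst lborel_eq_distr_glue[of i], subst nn_integral_distr) auto
  also have "\<dots> = (\<integral>\<^sup>+ x. \<integral>\<^sup>+ z. F (glue i x z) \<partial>lborel_others i \<partial>lborel)"
    by (subst others.nn_integral_fst[symmetric]) auto
  finally show ?thesis .
qed

section \<open>The marginal density and the conditional root mean square\<close>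

lemma marginal_nonneg: "(\<And>v. 0 \<le> f v) \<Longrightarrow> 0 \<le> marginal i f x"
  unfolding marginal_def by (rule integral_nonneg_AE) simp

lemma measurable_marginal:
  assumes [measurable]: "f \<in> borel_measurable borel"
  shows "marginal i f \<in> borel_measurable borel"
proof -
  interpret others: sigma_finite_measure "lborel_others i" by (rule sigma_finite_lborel_others)
  have "(\<lambda>x. \<integral>z. f (glue i x z) \<partial>lborel_others i) \<in> borel_measurable lborel"
    by (rule others.borel_measurable_lebesgue_integral) measurable
  then show ?thesis by (simp add: marginal_def[abs_def])
qed

lemma measurable_cond_rms:
  fixes f :: "real ^ 'n::finite \<Rightarrow> real"
  assumes [measurable]: "f \<in> borel_measurable borel"
  shows "cond_rms i f \<in> borel_measurable borel"
proof -
  interpret others: sigma_finite_measure "lborel_others i" by (rule sigma_finite_lborel_others)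
  have [measurable]: "marginal i f \<in> borel_measurable borel" by (rule measurable_marginal) fact
  have [measurable]: "(\<lambda>v :: real ^ 'n. (\<Sum>k\<in>UNIV. (v $ k)\<^sup>2) * f v) \<in> borel_measurable borel"
    by (intro borel_measurable_times borel_measurable_continuous_onI continuous_intros assms)
  have "(\<lambda>x. \<integral>z. (\<lambda>v. (\<Sum>k\<in>UNIV. (v $ k)\<^sup>2) * f v) (glue i x z) \<partial>lborel_others i)
      \<in> borel_measurable lborel"
    by (rule others.borel_measurable_lebesgue_integral) measurable
  then have [measurable]: "(\<lambda>x. \<integral>z. sq_slice i f x z \<partial>lborel_others i) \<in> borel_measurable borel"
    by (simp add: sq_slice_def)
  show ?thesis unfolding cond_rms_def[abs_def] by measurable
qed

lemma cond_rms_nonneg: "(\<And>v. 0 \<le> f v) \<Longrightarrow> 0 \<le> cond_rms i f x"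
  unfolding cond_rms_def sq_slice_def
  by (intro real_sqrt_ge_zero mult_nonneg_nonneg integral_nonneg_AE)
     (auto simp: marginal_nonneg intro!: sum_nonneg AE_I2 mult_nonneg_nonneg)

text \<open>A slice of infinite mass has marginal \<open>0\<close> by convention for non-integrable functions; such
  slices form a null set because the total mass is finite.\<close>

lemma marginal_density:
  assumes [measurable]: "f \<in> borel_measurable borel" and nonneg: "\<And>v. 0 \<le> f v"
    and mass: "(\<integral>\<^sup>+ v. ennreal (f v) \<partial>lborel) = 1"
  shows "integrable lborel (marginal i f)" "(\<integral>x. marginal i f x \<partial>lborel) = 1"
proof -
  interpret others: sigma_finite_measure "lborel_others i" by (rule sigma_finite_lborel_others)
  have [measurable]: "marginal i f \<in> borel_measurable borel" by (rule measurable_marginal) fact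
  define N where "N x = (\<integral>\<^sup>+ z. ennreal (f (glue i x z)) \<partial>lborel_others i)" for x
  have [measurable]: "N \<in> borel_measurable borel"
  proof -
    have "N \<in> borel_measurable lborel"
      unfolding N_def[abs_def] by (rule others.borel_measurable_nn_integral) measurable
    then show ?thesis by simp
  qed
  have N1: "(\<integral>\<^sup>+ x. N x \<partial>lborel) = 1"
    using nn_integral_slices[of "\<lambda>v. ennreal (f v)" i] mass by (simp add: N_def)
  then have "AE x in lborel. N x \<noteq> \<infinity>" by (intro nn_integral_noteq_infinite) auto
  then have "AE x in lborel. ennreal (marginal i f x) = N x"
  proof (rule AE_mp, intro AE_I2 impI)
    fix x assume fin: "N x \<noteq> \<infinity>"
    have "marginal i f x = enn2real (N x)"
      unfolding marginal_def N_def by (rule integral_eq_nn_integral) (auto simp: nonneg)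
    then show "ennreal (marginal i f x) = N x" using fin by (simp add: less_top)
  qed
  then have *: "(\<integral>\<^sup>+ x. ennreal (marginal i f x) \<partial>lborel) = 1"
    using N1 nn_integral_cong_AE[of "\<lambda>x. ennreal (marginal i f x)" N lborel] by simp
  show "integrable lborel (marginal i f)"
    by (rule integrableI_nonneg) (auto simp: * marginal_nonneg nonneg)
  show "(\<integral>x. marginal i f x \<partial>lborel) = 1"
    by (subst integral_eq_nn_integral) (auto simp: * marginal_nonneg nonneg)
qed

lemma cond_rms_ge_abs:
  assumes nonneg: "\<And>v. 0 \<le> f v" and pos: "0 < marginal i f x"
    and int: "integrable (lborel_others i) (sq_slice i f x)"
  shows "\<bar>x\<bar> \<le> cond_rms i f x"
proof -
  have "integrable (lborel_others i) (\<lambda>z. f (glue i x z))"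
    using pos not_integrable_integral_eq unfolding marginal_def by fastforce
  then have "(\<integral>z. x\<^sup>2 * f (glue i x z) \<partial>lborel_others i) \<le> (\<integral>z. sq_slice i f x z \<partial>lborel_others i)"
  proof (intro integral_mono int integrable_mult_right)
    fix z
    have "(glue i x z $ i)\<^sup>2 \<le> (\<Sum>k\<in>UNIV. (glue i x z $ k)\<^sup>2)" by (rule member_le_sum) auto
    then show "x\<^sup>2 * f (glue i x z) \<le> sq_slice i f x z"
      unfolding sq_slice_def by (intro mult_right_mono nonneg) (simp add: glue_def)
  qed
  then have "x\<^sup>2 \<le> inverse (marginal i f x) * (\<integral>z. sq_slice i f x z \<partial>lborel_others i)"
    using pos by (simp add: marginal_def field_simps)
  then have "sqrt (x\<^sup>2) \<le> cond_rms i f x" unfolding cond_rms_def by (rule real_sqrt_le_mono)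
  then show ?thesis by simp
qed

section \<open>Minimization under the entropy constraint\<close>

text \<open>This converts between the extended integral of the objective and the Bochner integral of
  a lower bound that may take negative values.\<close>

lemma nn_integral_lower_bound:
  fixes F l :: "'a \<Rightarrow> real"
  assumes [measurable]: "F \<in> borel_measurable N" and F: "\<And>x. 0 \<le> F x"
    and l: "integrable N l" and le: "AE x in N. l x \<le> F x"
    and nonneg: "0 \<le> (\<integral>x. l x \<partial>N)"
  shows "ennreal (\<integral>x. l x \<partial>N) \<le> (\<integral>\<^sup>+ x. ennreal (F x) \<partial>N)"
    and "(\<integral>\<^sup>+ x. ennreal (F x) \<partial>N) \<le> ennreal (\<integral>x. l x \<partial>N) \<Longrightarrow> AE x in N. F x = l x"
proof -
  have eq: "(\<integral>\<^sup>+ x. ennreal (F x) \<partial>N) = ennreal (\<integral>x. F x \<partial>N)" if "integrable N F"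
    using that by (intro nn_integral_eq_integral) (auto simp: F)
  have int: "integrable N F" if "(\<integral>\<^sup>+ x. ennreal (F x) \<partial>N) < \<infinity>"
    using that by (intro integrableI_nonneg) (auto simp: F)
  show "ennreal (\<integral>x. l x \<partial>N) \<le> (\<integral>\<^sup>+ x. ennreal (F x) \<partial>N)"
  proof (cases "(\<integral>\<^sup>+ x. ennreal (F x) \<partial>N) < \<infinity>")
    case True
    then show ?thesis using eq int integral_mono_AE[OF l _ le] by (simp add: ennreal_leI)
  next
    case False
    then show ?thesis by (simp add: less_top[symmetric])
  qed
  assume *: "(\<integral>\<^sup>+ x. ennreal (F x) \<partial>N) \<le> ennreal (\<integral>x. l x \<partial>N)"
  then have i: "integrable N F" by (intro int) (auto intro: le_less_trans)
  have l_le: "(\<integral>x. l x \<partial>N) \<le> (\<integral>x. F x \<partial>N)" by (rule integral_mono_AE[OF l i le])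
  have "(\<integral>x. F x \<partial>N) = (\<integral>x. l x \<partial>N)"
    using * l_le eq[OF i] nonneg by simp
  then have "(\<integral>x. F x - l x \<partial>N) = 0" using i l by simp
  then have "AE x in N. F x - l x = 0"
    using integral_nonneg_eq_0_iff_AE[of N "\<lambda>x. F x - l x"] i l le by simp
  then show "AE x in N. F x = l x" by simp
qed

lemma exp_eq_one_plus_iff: "exp y = 1 + y \<longleftrightarrow> y = 0" for y :: real
  using ln_eq_minus_one[of "exp y"] by auto

text \<open>The one-dimensional problem: \<open>p\<close> is a probability density, \<open>s\<close> a weight and \<open>c\<close> the
  constant for which \<open>c s\<close> satisfies the entropy constraint.\<close>

locale weighted_distortion_problem =
  fixes p s :: "real \<Rightarrow> real" and \<theta>1 M c :: real
  assumes p_int: "integrable lborel p" and p_nonneg: "\<And>x. 0 \<le> p x"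
    and p_mass: "(\<integral>x. p x \<partial>lborel) = 1"
    and s_meas [measurable]: "s \<in> borel_measurable borel" and s_nonneg: "\<And>x. 0 \<le> s x"
    and s_pos: "AE x in lborel. 0 < p x \<longrightarrow> 0 < s x"
    and log_s: "integrable lborel (\<lambda>x. p x * ln (s x))"
    and c_pos: "0 < c"
    and c_eq: "ln c = ln M - diff_entropy p - (\<integral>x. p x * ln (s x) \<partial>lborel)"
begin

lemma p_meas [measurable]: "p \<in> borel_measurable borel"
  using borel_measurable_integrable[OF p_int] by simp

lemma scaled_weight_feasible: "(\<lambda>x. c * s x) \<in> feasible p M"
proof -
  have *: "AE x in lborel. - p x * ln (inverse (c * s x)) = ln c * p x + p x * ln (s x)"
    using s_pos
  proof (rule AE_mp, intro AE_I2 impI)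
    fix x assume "0 < p x \<longrightarrow> 0 < s x"
    then show "- p x * ln (inverse (c * s x)) = ln c * p x + p x * ln (s x)"
      using p_nonneg[of x] c_pos
      by (cases "p x = 0") (auto simp: ln_inverse ln_mult algebra_simps)
  qed
  have int: "integrable lborel (\<lambda>x. ln c * p x + p x * ln (s x))"
    using p_int log_s by simp
  have "integrable lborel (\<lambda>x. - p x * ln (inverse (c * s x)))"
    by (rule integrable_cong_AE_imp[OF int]) (use * in auto)
  moreover have "(\<integral>x. - p x * ln (inverse (c * s x)) \<partial>lborel)
      = (\<integral>x. ln c * p x + p x * ln (s x) \<partial>lborel)"
    by (rule integral_cong_AE) (use * in auto)
  then have "(\<integral>x. - p x * ln (inverse (c * s x)) \<partial>lborel)
      = ln c + (\<integral>x. p x * ln (s x) \<partial>lborel)"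
    using p_int log_s p_mass by simp
  then have "quantized_entropy p (\<lambda>x. c * s x) = ln M"
    unfolding quantized_entropy_def using c_eq by simp
  ultimately show ?thesis
    unfolding feasible_def using c_pos s_nonneg s_pos by auto
qed

lemma distortion_scaled_weight:
  "AE x in lborel. distortion \<theta>1 s p (\<lambda>x. c * s x) x = 1 / 12 * \<theta>1\<^sup>2 * c powi (- 2) * p x"
  using s_pos
proof (rule AE_mp, intro AE_I2 impI)
  fix x assume "0 < p x \<longrightarrow> 0 < s x"
  then show "distortion \<theta>1 s p (\<lambda>x. c * s x) x = 1 / 12 * \<theta>1\<^sup>2 * c powi (- 2) * p x"
    using p_nonneg[of x] c_pos
    by (cases "p x = 0") (auto simp: distortion_def power_int_minus field_simps)
qed

lemma measurable_distortion:
  assumes [measurable]: "g \<in> borel_measurable borel"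
  shows "distortion \<theta>1 s p g \<in> borel_measurable borel"
  unfolding distortion_def[abs_def] power_int_minus power_int_numeral by measurable

lemma distortion_nonneg: "0 \<le> distortion \<theta>1 s p g x"
  unfolding distortion_def power_int_minus power_int_numeral
  using p_nonneg[of x] by (intro mult_nonneg_nonneg) auto

lemma integral_distortion_scaled_weight:
  "integrable lborel (distortion \<theta>1 s p (\<lambda>x. c * s x))"
  "(\<integral>x. distortion \<theta>1 s p (\<lambda>x. c * s x) x \<partial>lborel) = 1 / 12 * \<theta>1\<^sup>2 * c powi (- 2)"
proof -
  have [measurable]: "distortion \<theta>1 s p (\<lambda>x. c * s x) \<in> borel_measurable borel"
    by (rule measurable_distortion) measurable
  have int: "integrable lborel (\<lambda>x. 1 / 12 * \<theta>1\<^sup>2 * c powi (- 2) * p x)" using p_int by simp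
  show "integrable lborel (distortion \<theta>1 s p (\<lambda>x. c * s x))"
    by (rule integrable_cong_AE_imp[OF int]) (use distortion_scaled_weight in auto)
  have "(\<integral>x. distortion \<theta>1 s p (\<lambda>x. c * s x) x \<partial>lborel)
      = (\<integral>x. 1 / 12 * \<theta>1\<^sup>2 * c powi (- 2) * p x \<partial>lborel)"
    by (rule integral_cong_AE) (use distortion_scaled_weight in auto)
  then show "(\<integral>x. distortion \<theta>1 s p (\<lambda>x. c * s x) x \<partial>lborel) = 1 / 12 * \<theta>1\<^sup>2 * c powi (- 2)"
    using p_int p_mass by simp
qed

lemma nn_integral_distortion_scaled_weight:
  "(\<integral>\<^sup>+ x. ennreal (distortion \<theta>1 s p (\<lambda>x. c * s x) x) \<partial>lborel)
     = ennreal (1 / 12 * \<theta>1\<^sup>2 * c powi (- 2))"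
  using nn_integral_eq_integral[OF integral_distortion_scaled_weight(1)]
  by (simp add: distortion_nonneg integral_distortion_scaled_weight(2))

text \<open>The linearization at \<open>c s\<close> of the distortion as a function of \<open>ln g\<close>; the entropy constraint
  is linear in \<open>ln g\<close>, which is why its integral does not depend on \<open>g\<close>.\<close>

definition tangent :: "(real \<Rightarrow> real) \<Rightarrow> real \<Rightarrow> real" where
  "tangent g x = 1 / 12 * \<theta>1\<^sup>2 * c powi (- 2) * (p x * (1 + 2 * ln (c * s x / g x)))"

lemma integral_tangent:
  assumes g: "g \<in> feasible p M"
  shows "integrable lborel (tangent g)"
    and "(\<integral>x. tangent g x \<partial>lborel) = 1 / 12 * \<theta>1\<^sup>2 * c powi (- 2)"
proof -
  have [measurable]: "g \<in> borel_measurable borel"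
    and gpos: "AE x in lborel. 0 < p x \<longrightarrow> 0 < g x"
    and gint: "integrable lborel (\<lambda>x. - p x * ln (inverse (g x)))"
    and gent: "quantized_entropy p g = ln M"
    using g by (auto simp: feasible_def)
  let ?h = "\<lambda>x. p x * (1 + 2 * ln (c * s x / g x))"
  let ?k = "\<lambda>x. (1 + 2 * ln c) * p x + 2 * (p x * ln (s x)) - 2 * (- p x * ln (inverse (g x)))"
  have *: "AE x in lborel. ?h x = ?k x"
    using s_pos gpos
  proof eventually_elim
    fix x assume "0 < p x \<longrightarrow> 0 < s x" "0 < p x \<longrightarrow> 0 < g x"
    then show "?h x = ?k x" using p_nonneg[of x] c_pos
      by (cases "p x = 0") (auto simp: ln_inverse ln_mult ln_div algebra_simps)
  qed
  have intk: "integrable lborel ?k" using p_int log_s gint by simp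
  have inth: "integrable lborel ?h"
    by (rule integrable_cong_AE_imp[OF intk]) (use * in auto)
  have "(\<integral>x. ?h x \<partial>lborel) = (\<integral>x. ?k x \<partial>lborel)" by (rule integral_cong_AE) (use * in auto)
  also have "\<dots> = (1 + 2 * ln c) * (\<integral>x. p x \<partial>lborel) + 2 * (\<integral>x. p x * ln (s x) \<partial>lborel)
      - 2 * (\<integral>x. - p x * ln (inverse (g x)) \<partial>lborel)"
    by (subst Bochner_Integration.integral_diff, use p_int log_s gint in simp, use gint in simp,
        subst Bochner_Integration.integral_add, use p_int in simp, use log_s in simp) simp
  also have "\<dots> = 1"
    using gent c_eq p_mass by (simp add: quantized_entropy_def)
  finally have h1: "(\<integral>x. ?h x \<partial>lborel) = 1" .
  show "integrable lborel (tangent g)" unfolding tangent_def[abs_def] using inth by simp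
  show "(\<integral>x. tangent g x \<partial>lborel) = 1 / 12 * \<theta>1\<^sup>2 * c powi (- 2)"
    unfolding tangent_def using h1 by simp
qed

lemma distortion_eq_exp:
  assumes "0 < s x" "0 < g x"
  shows "distortion \<theta>1 s p g x
    = 1 / 12 * \<theta>1\<^sup>2 * c powi (- 2) * (p x * exp (2 * ln (c * s x / g x)))"
proof -
  have "exp (2 * ln (c * s x / g x)) = (c * s x / g x)\<^sup>2"
    using assms c_pos by (simp add: exp_double)
  then show ?thesis
    using assms c_pos by (simp add: distortion_def power_int_minus field_simps)
qed

lemma tangent_le_distortion:
  assumes g: "g \<in> feasible p M"
  shows "AE x in lborel. tangent g x \<le> distortion \<theta>1 s p g x"
proof -
  have "AE x in lborel. 0 < p x \<longrightarrow> 0 < g x" using g by (auto simp: feasible_def)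
  with s_pos show ?thesis
  proof eventually_elim
    fix x assume pos: "0 < p x \<longrightarrow> 0 < s x" "0 < p x \<longrightarrow> 0 < g x"
    show "tangent g x \<le> distortion \<theta>1 s p g x"
    proof (cases "p x = 0")
      case True then show ?thesis by (simp add: tangent_def distortion_def)
    next
      case False
      then have "0 < s x" "0 < g x" using pos p_nonneg[of x] by auto
      then show ?thesis
        unfolding tangent_def
        by (subst distortion_eq_exp) (auto intro!: mult_left_mono simp: p_nonneg less_imp_le[OF c_pos])
    qed
  qed
qed

text \<open>Equality in the tangent bound forces \<open>ln (c s / g) = 0\<close>.\<close>

lemma minimal_distortion_unique:
  assumes g: "g \<in> feasible p M" and \<theta>1: "\<theta>1 \<noteq> 0"
    and le: "(\<integral>\<^sup>+ x. ennreal (distortion \<theta>1 s p g x) \<partial>lborel) \<le> ennreal (1 / 12 * \<theta>1\<^sup>2 * c powi (- 2))"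
  shows "AE x in lborel. 0 < p x \<longrightarrow> g x = c * s x"
proof -
  have gm: "g \<in> borel_measurable borel" using g by (auto simp: feasible_def)
  have "AE x in lborel. distortion \<theta>1 s p g x = tangent g x"
    by (rule nn_integral_lower_bound(2))
       (use gm le g in \<open>auto simp: measurable_distortion distortion_nonneg integral_tangent
          tangent_le_distortion less_imp_le[OF c_pos]\<close>)
  moreover have "AE x in lborel. 0 < p x \<longrightarrow> 0 < g x" using g by (auto simp: feasible_def)
  ultimately show ?thesis using s_pos
  proof eventually_elim
    fix x assume eq: "distortion \<theta>1 s p g x = tangent g x"
      and pos: "0 < p x \<longrightarrow> 0 < g x" "0 < p x \<longrightarrow> 0 < s x"
    show "0 < p x \<longrightarrow> g x = c * s x"
    proof
      assume p: "0 < p x"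
      then have sg: "0 < s x" "0 < g x" using pos by auto
      then have "exp (2 * ln (c * s x / g x)) = 1 + 2 * ln (c * s x / g x)"
        using eq distortion_eq_exp[of x g, OF sg] p \<theta>1 c_pos by (simp add: tangent_def)
      then have "ln (c * s x / g x) = 0"
        using exp_eq_one_plus_iff[of "2 * ln (c * s x / g x)"] by simp
      then show "g x = c * s x" using sg c_pos by (simp add: ln_eq_zero_iff)
    qed
  qed
qed

lemma scaled_weight_optimal:
  assumes G: "G \<subseteq> feasible p M" "(\<lambda>x. c * s x) \<in> G"
  shows "optimal_density \<theta>1 s p G (\<lambda>x. c * s x)"
  unfolding optimal_density_def is_arg_min_def
proof (intro conjI notI)
  assume "\<exists>g. g \<in> G \<and> (\<integral>\<^sup>+ x. ennreal (distortion \<theta>1 s p g x) \<partial>lborel)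
      < (\<integral>\<^sup>+ x. ennreal (distortion \<theta>1 s p (\<lambda>x. c * s x) x) \<partial>lborel)"
  then obtain g where g: "g \<in> feasible p M"
    and less: "(\<integral>\<^sup>+ x. ennreal (distortion \<theta>1 s p g x) \<partial>lborel)
      < ennreal (1 / 12 * \<theta>1\<^sup>2 * c powi (- 2))"
    using G unfolding nn_integral_distortion_scaled_weight by auto
  have "ennreal (\<integral>x. tangent g x \<partial>lborel) \<le> (\<integral>\<^sup>+ x. ennreal (distortion \<theta>1 s p g x) \<partial>lborel)"
    by (rule nn_integral_lower_bound(1))
       (use g in \<open>auto simp: measurable_distortion distortion_nonneg integral_tangent
          tangent_le_distortion less_imp_le[OF c_pos] feasible_def\<close>)
  then show False using less integral_tangent(2)[OF g] by simp
qed (use G in auto)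

lemma optimal_density_unique:
  assumes G: "G \<subseteq> feasible p M" "(\<lambda>x. c * s x) \<in> G" and \<theta>1: "\<theta>1 \<noteq> 0"
    and opt: "optimal_density \<theta>1 s p G g"
  shows "AE x in lborel. 0 < p x \<longrightarrow> g x = c * s x"
proof (rule minimal_distortion_unique)
  show "g \<in> feasible p M" using opt G by (auto simp: optimal_density_def is_arg_min_def)
  show "(\<integral>\<^sup>+ x. ennreal (distortion \<theta>1 s p g x) \<partial>lborel) \<le> ennreal (1 / 12 * \<theta>1\<^sup>2 * c powi (- 2))"
    using opt G(2) unfolding nn_integral_distortion_scaled_weight[symmetric]
    by (auto simp: optimal_density_def is_arg_min_def not_less)
qed (fact \<theta>1)

end

section \<open>The optimal density of quantized subsections\<close>


theorem theorem3p2: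
  fixes P :: "'w measure"
    and u :: "int \<Rightarrow> 'w \<Rightarrow> real"
    and t :: int
    and idx :: "'n::finite \<Rightarrow> nat"
    and i1 :: 'n
    and T :: "real ^ 'n ^ 'n"
    and \<theta> :: "real ^ 'n"
    and \<theta>1 M K L :: real
    and f :: "real ^ 'n \<Rightarrow> real"
    and f1 \<sigma> gv :: "real \<Rightarrow> real"
  assumes prob: "prob_space P"
    and indep: "prob_space.indep_vars P (\<lambda>_. borel) u UNIV"
    and idx: "bij_betw idx UNIV {..<CARD('n)}" "idx i1 = 0"
    and T: "orthogonal_matrix T" "matrix_inv T *v \<theta> = axis i1 \<theta>1"
    and density: "distributed P lborel (\<lambda>w. regressor idx u t w v* T) (\<lambda>x. ennreal (f x))"
    and f_nonneg: "\<And>x. 0 \<le> f x"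
    and f_cont: "continuous_on UNIV f"
    and f_expansion: "\<And>a. second_order_expansion f a"
    and f1: "f1 = marginal i1 f"
    and \<sigma>: "\<sigma> = cond_rms i1 f"
    and \<sigma>_finite: "\<And>x. integrable (lborel_others i1) (sq_slice i1 f x)"
    and \<sigma>_slope: "\<And>x. (\<lambda>x. (\<sigma> x)\<^sup>2 * f1 x) differentiable at x"
    and entropy_exists: "integrable lborel (\<lambda>x. - f1 x * ln (f1 x))"
    and log_\<sigma>_exists: "integrable lborel (\<lambda>x. f1 x * ln (\<sigma> x))"
    and M: "0 < M"
    and L: "L = - diff_entropy f1 - (\<integral>x. f1 x * ln (\<sigma> x) \<partial>lborel)"
    and K: "K = exp L"
    and gv: "gv = (\<lambda>x. K * M * \<sigma> x)"
  shows "L = (\<integral>x. f1 x * ln (f1 x / \<sigma> x) \<partial>lborel)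
    \<and> optimal_density \<theta>1 \<sigma> f1 (feasible f1 M) gv
    \<and> (\<theta>1 \<noteq> 0 \<longrightarrow> (\<forall>g. optimal_density \<theta>1 \<sigma> f1 (feasible f1 M) g
          \<longrightarrow> (AE x in lborel. 0 < f1 x \<longrightarrow> g x = gv x)))
    \<and> (gv \<in> finite_slope f1 \<longrightarrow>
          optimal_density \<theta>1 \<sigma> f1 (feasible f1 M \<inter> finite_slope f1) gv
          \<and> (\<theta>1 \<noteq> 0 \<longrightarrow> (\<forall>g. optimal_density \<theta>1 \<sigma> f1 (feasible f1 M \<inter> finite_slope f1) g
                \<longrightarrow> (AE x in lborel. 0 < f1 x \<longrightarrow> g x = gv x))))
    \<and> integrable lborel (distortion \<theta>1 \<sigma> f1 gv)
    \<and> (\<integral>x. distortion \<theta>1 \<sigma> f1 gv x \<partial>lborel) = 1 / 12 * \<theta>1\<^sup>2 * K powi (- 2) * M powi (- 2)"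
proof -
  interpret prob_space P by (rule prob)
  have f_meas: "f \<in> borel_measurable borel" by (rule borel_measurable_continuous_onI[OF f_cont])
  have mass: "(\<integral>\<^sup>+ v. ennreal (f v) \<partial>lborel) = 1"
    using distributed_nn_integral[OF density, of "\<lambda>_. 1"] emeasure_space_1 by simp
  have "AE x :: real in lborel. x \<noteq> 0" by (rule AE_lborel_singleton)
  then have \<sigma>_pos: "AE x in lborel. 0 < f1 x \<longrightarrow> 0 < \<sigma> x"
  proof (rule AE_mp, intro AE_I2 impI)
    fix x :: real assume "x \<noteq> 0" "0 < f1 x"
    then show "0 < \<sigma> x"
      using cond_rms_ge_abs[of f i1 x] f_nonneg \<sigma>_finite[of x] by (simp add: f1 \<sigma>)
  qed
  have f1_props: "integrable lborel f1" "(\<integral>x. f1 x \<partial>lborel) = 1" "\<And>x. 0 \<le> f1 x"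
    unfolding f1
    using marginal_density[OF f_meas f_nonneg mass] marginal_nonneg[of f, OF f_nonneg] by auto
  have [measurable]: "f1 \<in> borel_measurable borel" "\<sigma> \<in> borel_measurable borel"
    unfolding f1 \<sigma> by (intro measurable_marginal measurable_cond_rms f_meas)+
  interpret weighted_distortion_problem f1 \<sigma> \<theta>1 M "K * M"
  proof
    show "ln (K * M) = ln M - diff_entropy f1 - (\<integral>x. f1 x * ln (\<sigma> x) \<partial>lborel)"
      using M by (simp add: K L ln_mult)
    show "0 \<le> \<sigma> x" for x unfolding \<sigma> by (rule cond_rms_nonneg[OF f_nonneg])
  qed (use f1_props \<sigma>_pos log_\<sigma>_exists M in \<open>auto simp: K\<close>)
  have "L = (\<integral>x. f1 x * ln (f1 x / \<sigma> x) \<partial>lborel)"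
  proof -
    have "(\<integral>x. f1 x * ln (f1 x / \<sigma> x) \<partial>lborel)
        = (\<integral>x. - (- f1 x * ln (f1 x)) - f1 x * ln (\<sigma> x) \<partial>lborel)"
    proof (rule integral_cong_AE)
      show "AE x in lborel. f1 x * ln (f1 x / \<sigma> x) = - (- f1 x * ln (f1 x)) - f1 x * ln (\<sigma> x)"
        using \<sigma>_pos
      proof (rule AE_mp, intro AE_I2 impI)
        fix x assume "0 < f1 x \<longrightarrow> 0 < \<sigma> x"
        then show "f1 x * ln (f1 x / \<sigma> x) = - (- f1 x * ln (f1 x)) - f1 x * ln (\<sigma> x)"
          using f1_props(3)[of x] by (cases "f1 x = 0") (auto simp: ln_div algebra_simps)
      qed
    qed measurable
    also have "\<dots> = - (\<integral>x. - f1 x * ln (f1 x) \<partial>lborel) - (\<integral>x. f1 x * ln (\<sigma> x) \<partial>lborel)"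
      by (subst Bochner_Integration.integral_diff,
          rule integrable_minus[OF entropy_exists], rule log_\<sigma>_exists,
          subst integral_minus, rule refl)
    finally show ?thesis by (simp add: L diff_entropy_def)
  qed
  moreover have "K powi (- 2) * M powi (- 2) = (K * M) powi (- 2)"
    by (simp add: power_int_mult_distrib)
  moreover have "gv \<in> feasible f1 M" unfolding gv by (rule scaled_weight_feasible)
  ultimately show ?thesis
    using scaled_weight_optimal[of "feasible f1 M"] optimal_density_unique[of "feasible f1 M"]
      scaled_weight_optimal[of "feasible f1 M \<inter> finite_slope f1"]
      optimal_density_unique[of "feasible f1 M \<inter> finite_slope f1"]
      integral_distortion_scaled_weight
    unfolding gv by (auto simp: mult.assoc)
qed

end
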